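(* Let $n\in\{p_1^{k},\,p_1^{k}p_2,\,p_1^{2}p_2^{2},\,p_1p_2p_3,\,p_1^{2}p_2p_3,\,p_1p_2p_3p_4 : p_1,p_2,p_3,p_4 \text{ are primes and } k\ge 1\}$, and let $p$ and $q$ be primes such that $pq$ divides $n$ and $pq$ is coprime to $n/pq$. Let $S$ be an inverse-closed subset of $\mathbb{Z}_n\setminus\{0\}$ such that $\langle S\rangle=\mathbb{Z}_n$, $|S|=pq$ and $S$ is aperiodic. Then $\mathrm{Cay}(\mathbb{Z}_n,S)$ admits a total perfect code if and only if $s\not\equiv s'\pmod{pq}$ for all distinct $s,s'\in S$.
   Context: Inverse-closed means $-S=S$. The Cayley graph $\mathrm{Cay}(\mathbb{Z}_n,S)$ has vertex set $\mathbb{Z}_n$, with $x,y$ adjacent iff $y-x\in S$. A total perfect code in a graph is a set $C$ of vertices such that every vertex of the graph (including those in $C$) is adjacent to exactly one vertex of $C$. A nonempty subset $X$ of an abelian group $G$ is periodic if $\{g\in G: X+g=X\}\neq\{0\}$, and aperiodic otherwise. *)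

theory Defs
  imports
    "HOL-Computational_Algebra.Primes"
    "HOL-Number_Theory.Cong"
    "HOL-Algebra.Coset"
    "HOL-Algebra.Generated_Groups"
    "HOL-Algebra.Elementary_Groups"
    "Graph_Theory.Pair_Digraph"
begin

text \<open>Abelian groups are written multiplicatively, as in HOL-Algebra. The group \<open>\<int>\<^sub>n\<close> is
  \<^const>\<open>integer_mod_group\<close>, whose carrier for \<open>n > 0\<close> is the set of integers from \<open>0\<close> to \<open>n - 1\<close>,
  with addition modulo \<open>n\<close>.\<close>

definition inverse_closed :: "('a, 'm) monoid_scheme \<Rightarrow> 'a set \<Rightarrow> bool" where
  "inverse_closed G S \<longleftrightarrow> set_inv\<^bsub>G\<^esub> S = S"

definition periodic :: "('a, 'm) monoid_scheme \<Rightarrow> 'a set \<Rightarrow> bool" where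
  "periodic G X \<longleftrightarrow>
     X \<noteq> {} \<and> X \<subseteq> carrier G \<and> {g \<in> carrier G. X #>\<^bsub>G\<^esub> g = X} \<noteq> {\<one>\<^bsub>G\<^esub>}"

definition aperiodic :: "('a, 'm) monoid_scheme \<Rightarrow> 'a set \<Rightarrow> bool" where
  "aperiodic G X \<longleftrightarrow> X \<noteq> {} \<and> X \<subseteq> carrier G \<and> \<not> periodic G X"

definition cayley_graph :: "('a, 'm) monoid_scheme \<Rightarrow> 'a set \<Rightarrow> 'a pair_pre_digraph" where
  "cayley_graph G S =
     \<lparr> pverts = carrier G,
       parcs = {(x, y). x \<in> carrier G \<and> y \<in> carrier G \<and> y \<otimes>\<^bsub>G\<^esub> inv\<^bsub>G\<^esub> x \<in> S} \<rparr>"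

text \<open>Undirected graphs are symmetric digraphs in the AFP entry Graph Theory; for an
  inverse-closed connection set without the identity the Cayley graph is a finite simple graph
  in that sense.\<close>

lemma (in group) pair_graph_cayley_graph:
  assumes "finite (carrier G)" "S \<subseteq> carrier G - {\<one>}" "inverse_closed G S"
  shows "pair_graph (cayley_graph G S)"
proof
  have inv_S: "inv s \<in> S" if "s \<in> S" for s
    using assms(3) that unfolding inverse_closed_def SET_INV_def by auto
  have "x \<otimes> inv y \<in> S" if "x \<in> carrier G" "y \<in> carrier G" "y \<otimes> inv x \<in> S" for x y
    using inv_S[OF that(3)] that(1,2) by (simp add: inv_mult_group)
  then show "symmetric (with_proj (cayley_graph G S))"
    by (auto simp: symmetric_def cayley_graph_def intro!: symI)
  show "finite (parcs (cayley_graph G S))"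
    by (rule finite_subset[of _ "carrier G \<times> carrier G"])
      (auto simp: cayley_graph_def assms(1))
qed (use assms in \<open>auto simp: cayley_graph_def\<close>)

definition total_perfect_code :: "('a, 'b) pre_digraph \<Rightarrow> 'a set \<Rightarrow> bool" where
  "total_perfect_code G C \<longleftrightarrow>
     C \<subseteq> verts G \<and> (\<forall>v \<in> verts G. \<exists>!c. c \<in> C \<and> v \<rightarrow>\<^bsub>G\<^esub> c)"

end

theory Submission
  imports Defs "HOL-Computational_Algebra.Polynomial"
begin

text \<open>
  By the definition of adjacency, a total perfect code is a set \<open>C\<close> for which every \<open>v\<close> in \<open>\<int>\<^sub>n\<close> is uniquely
  \<open>c - s\<close> with \<open>s \<in> S\<close>, \<open>c \<in> C\<close>: the sets \<open>- S\<close> and \<open>C\<close> tile \<open>\<int>\<^sub>n\<close>.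

  If the elements of \<open>S\<close> are pairwise incongruent modulo \<open>pq = |S|\<close>, they form a complete residue
  system, and the multiples of \<open>pq\<close> are a code.

  For the converse, the key is the theorem of Sands and Tijdeman: if \<open>A + B\<close> is a tiling of \<open>\<int>\<^sub>n\<close>
  and \<open>k\<close> is coprime to \<open>|A|\<close>, then \<open>k A + B\<close> is a tiling as well
  (\<open>cyclic_tiling_coprime_multiple\<close>). Applied to \<open>A = - S\<close> and \<open>k = n / pq\<close>, it shows that the
  multiples \<open>k s\<close> with \<open>s \<in> S\<close> are distinct modulo \<open>n = k p q\<close>, that is, the \<open>s\<close> are distinct
  modulo \<open>pq\<close>.

  It suffices to prove the theorem for a prime \<open>k = r\<close> (\<open>cyclic_tiling_prime_multiple\<close>). Work in
  \<open>\<int>[x] / (x\<^sup>n - 1)\<close>, the group ring of \<open>\<int>\<^sub>n\<close>, and let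
  \<open>F = (\<Sum>a\<in>A. x\<^sup>a)\<close>, \<open>H = (\<Sum>b\<in>B. x\<^sup>b)\<close> and \<open>G = 1 + x + \<dots> + x\<^bsup>n-1\<^esup>\<close>. The tiling says
  \<open>F H = G\<close>, and \<open>F G = |A| G\<close>, so \<open>F\<^sup>r H = |A|\<^bsup>r-1\<^esup> G\<close>. Modulo \<open>r\<close>, the power \<open>F\<^sup>r\<close> is
  \<open>F(x\<^sup>r)\<close>, hence the number of representations of any residue as \<open>r a + b\<close> is congruent to
  \<open>|A|\<^bsup>r-1\<^esup>\<close> modulo \<open>r\<close>. As \<open>r\<close> does not divide \<open>|A|\<close>, every residue is represented, and since
  there are only \<open>|A| |B| = n\<close> pairs, every residue is represented once.
\<close>

section \<open>The Frobenius congruence\<close>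

lemma prime_dvd_freshmans_dream:
  fixes x y :: "'a :: comm_ring_1"
  assumes "prime r"
  shows "of_nat r dvd (x + y) ^ r - (x ^ r + y ^ r)"
proof -
  have r: "r > 0" using assms prime_gt_0_nat by blast
  have split: "{..r} = insert 0 (insert r {1..<r})" using r by auto
  have "(x + y) ^ r = (\<Sum>k\<le>r. of_nat (r choose k) * x ^ k * y ^ (r - k))"
    by (rule binomial_ring)
  also have "\<dots> = x ^ r + y ^ r + (\<Sum>k\<in>{1..<r}. of_nat (r choose k) * x ^ k * y ^ (r - k))"
    using r by (simp add: split)
  finally have "(x + y) ^ r - (x ^ r + y ^ r)
      = (\<Sum>k\<in>{1..<r}. of_nat (r choose k) * x ^ k * y ^ (r - k))"
    by simp
  moreover have "of_nat r dvd (of_nat (r choose k) * x ^ k * y ^ (r - k) :: 'a)"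
    if "k \<in> {1..<r}" for k
  proof -
    have "r dvd (r choose k)"
      using that assms r by (intro dvd_choose_prime) auto
    then have "(of_nat r :: 'a) dvd of_nat (r choose k)"
      by (metis dvd_def of_nat_mult)
    then show ?thesis by (simp add: dvd_mult2)
  qed
  ultimately show ?thesis by (metis (no_types, lifting) dvd_sum)
qed

lemma prime_dvd_freshmans_dream_sum:
  fixes f :: "'b \<Rightarrow> 'a :: comm_ring_1"
  assumes "prime r" "finite A"
  shows "of_nat r dvd (\<Sum>a\<in>A. f a) ^ r - (\<Sum>a\<in>A. f a ^ r)"
  using assms(2)
proof induction
  case empty
  then show ?case using assms(1) prime_gt_0_nat[of r] by (simp add: zero_power)
next
  case (insert a A)
  have "(f a + sum f A) ^ r - (f a ^ r + (\<Sum>a\<in>A. f a ^ r))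
      = ((f a + sum f A) ^ r - (f a ^ r + sum f A ^ r)) + (sum f A ^ r - (\<Sum>a\<in>A. f a ^ r))"
    by simp
  moreover have "of_nat r dvd \<dots>"
    using insert.IH by (intro dvd_add prime_dvd_freshmans_dream assms(1))
  ultimately show ?case using insert.hyps by (simp only: sum.insert simp_thms)
qed

section \<open>Integer polynomials modulo \<open>x\<^sup>n - 1\<close>\<close>

definition cyclic_cong :: "nat \<Rightarrow> int poly \<Rightarrow> int poly \<Rightarrow> bool" where
  "cyclic_cong n P Q \<longleftrightarrow> monom 1 n - 1 dvd P - Q"

lemma cyclic_cong_trans: "cyclic_cong n P Q \<Longrightarrow> cyclic_cong n Q R \<Longrightarrow> cyclic_cong n P R"
  unfolding cyclic_cong_def using dvd_add[of _ "P - Q" "Q - R"] by simp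

lemma cyclic_cong_sym: "cyclic_cong n P Q \<Longrightarrow> cyclic_cong n Q P"
  unfolding cyclic_cong_def using dvd_minus_iff[of _ "P - Q"] by simp

lemma cyclic_cong_add:
  "cyclic_cong n P Q \<Longrightarrow> cyclic_cong n P' Q' \<Longrightarrow> cyclic_cong n (P + P') (Q + Q')"
  unfolding cyclic_cong_def using dvd_add[of _ "P - Q" "P' - Q'"] by (simp add: algebra_simps)

lemma cyclic_cong_mult_left: "cyclic_cong n P Q \<Longrightarrow> cyclic_cong n (R * P) (R * Q)"
  unfolding cyclic_cong_def by (simp add: right_diff_distrib[symmetric])

lemma cyclic_cong_sum:
  "(\<And>i. i \<in> I \<Longrightarrow> cyclic_cong n (P i) (Q i)) \<Longrightarrow> cyclic_cong n (\<Sum>i\<in>I. P i) (\<Sum>i\<in>I. Q i)"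
  unfolding cyclic_cong_def by (simp add: sum_subtractf[symmetric] dvd_sum)

lemma cyclic_cong_monom_mod: "cyclic_cong n (monom c i) (monom c (i mod n))"
proof -
  have pow: "monom (1 :: int) n ^ (i div n) = monom 1 (n * (i div n))"
    by (simp add: monom_power)
  have "monom 1 n - 1 dvd monom (1::int) n ^ (i div n) - 1 ^ (i div n)"
    by (simp only: power_diff_sumr2 dvd_triv_left)
  then have "monom 1 n - 1 dvd monom c (i mod n) * (monom (1::int) (n * (i div n)) - 1)"
    by (simp add: pow)
  moreover have "monom c (i mod n) * (monom (1::int) (n * (i div n)) - 1)
      = monom c i - monom c (i mod n)"
    by (simp add: right_diff_distrib mult_monom)
  ultimately show ?thesis by (simp add: cyclic_cong_def)
qed

text \<open>For \<open>n > 0\<close> every class has a representative of degree less than \<open>n\<close>, given here explicitly by folding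
  the coefficients; by \<open>cyclic_cong_imp_eq\<close> it is the only one. Thus congruences between such
  representatives can be read off coefficientwise, although \<open>\<int>[x]\<close> is not Euclidean.\<close>

lemma cyclic_cong_reduce:
  "cyclic_cong n P (\<Sum>i\<le>degree P. monom (coeff P i) (i mod n))"
proof -
  have "cyclic_cong n (\<Sum>i\<le>degree P. monom (coeff P i) i)
      (\<Sum>i\<le>degree P. monom (coeff P i) (i mod n))"
    by (intro cyclic_cong_sum cyclic_cong_monom_mod)
  then show ?thesis by (simp add: poly_as_sum_of_monoms)
qed

lemma cyclic_cong_imp_eq:
  assumes "cyclic_cong n P Q" "degree P < n" "degree Q < n"
  shows "P = Q"
proof (rule ccontr)
  assume "P \<noteq> Q"
  then have "degree (monom 1 n - 1 :: int poly) \<le> degree (P - Q)"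
    using assms(1) by (auto simp: cyclic_cong_def intro: dvd_imp_degree_le)
  moreover have "degree (monom 1 n - 1 :: int poly) = n"
    using degree_add_eq_left[of "-1" "monom (1::int) n"] assms(2) by (simp add: degree_monom_eq)
  moreover have "degree (P - Q) < n"
    using assms by (meson degree_diff_less)
  ultimately show False by simp
qed

lemma degree_sum_monom_mod_less:
  "n > 0 \<Longrightarrow> degree (\<Sum>i\<in>I. monom (c i) (h i mod n)) < n"
  by (rule degree_sum_less) (auto intro: le_less_trans[OF degree_monom_le])

lemma coeff_sum_monom:
  "finite I \<Longrightarrow> coeff (\<Sum>i\<in>I. monom (1::int) (h i)) j = int (card {i \<in> I. h i = j})"
  by (simp add: coeff_sum sum.If_cases Int_def)

lemma bij_betw_add_mod:
  assumes "n > (0::nat)"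
  shows "bij_betw (\<lambda>j. (c + j) mod n) {..<n} {..<n}"
proof -
  have inj: "inj_on (\<lambda>j. (c + j) mod n) {..<n}"
  proof (rule inj_onI)
    fix i j assume "i \<in> {..<n}" "j \<in> {..<n}" "(c + i) mod n = (c + j) mod n"
    then show "i = j"
      using cong_add_lcancel_nat[of c i j n] by (simp add: cong_def)
  qed
  moreover have "(\<lambda>j. (c + j) mod n) ` {..<n} \<subseteq> {..<n}" using assms by auto
  ultimately show ?thesis
    by (simp add: bij_betw_def endo_inj_surj)
qed

section \<open>Tilings of cyclic groups\<close>

text \<open>The two tiles are families rather than sets, so that multiplying a tile by \<open>k\<close> is meaningful
  before \<open>a \<mapsto> k a\<close> is known to be injective on it.\<close>

definition cyclic_tiling ::
  "nat \<Rightarrow> ('a \<Rightarrow> nat) \<Rightarrow> 'a set \<Rightarrow> ('b \<Rightarrow> nat) \<Rightarrow> 'b set \<Rightarrow> bool" where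
  "cyclic_tiling n f A g B \<longleftrightarrow> bij_betw (\<lambda>(a, b). (f a + g b) mod n) (A \<times> B) {..<n}"

text \<open>Below, \<open>Fr\<close> is \<open>F(x\<^sup>r)\<close>, and the coefficients of \<open>K\<close> count the representations of the residues
  as \<open>r f(a) + g(b)\<close>. The error term of the Frobenius congruence, a multiple of \<open>r\<close>, is folded to
  degree less than \<open>n\<close> as well, which turns the congruence modulo \<open>x\<^sup>n - 1\<close> into an equation
  between polynomials.\<close>

lemma cyclic_tiling_prime_multiple:
  assumes "finite A" "finite B" "n > 0" "cyclic_tiling n f A g B"
    and r: "prime r" "\<not> r dvd card A"
  shows "cyclic_tiling n (\<lambda>a. r * f a) A g B"
proof -
  define F :: "int poly" where "F = (\<Sum>a\<in>A. monom 1 (f a))"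
  define Fr :: "int poly" where "Fr = (\<Sum>a\<in>A. monom 1 (r * f a))"
  define H :: "int poly" where "H = (\<Sum>b\<in>B. monom 1 (g b))"
  define G :: "int poly" where "G = (\<Sum>j<n. monom 1 j)"
  define K :: "int poly" where "K = (\<Sum>(a, b)\<in>A \<times> B. monom 1 ((r * f a + g b) mod n))"
  have FH: "cyclic_cong n (F * H) G"
  proof -
    have "F * H = (\<Sum>(a, b)\<in>A \<times> B. monom 1 (f a + g b))"
      by (simp add: F_def H_def sum_product mult_monom sum.cartesian_product)
    moreover have "cyclic_cong n \<dots> (\<Sum>(a, b)\<in>A \<times> B. monom 1 ((f a + g b) mod n))"
      by (intro cyclic_cong_sum) (auto intro: cyclic_cong_monom_mod)
    moreover have "(\<Sum>(a, b)\<in>A \<times> B. monom 1 ((f a + g b) mod n)) = G"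
      using sum.reindex_bij_betw[OF assms(4)[unfolded cyclic_tiling_def], of "monom (1::int)"]
      by (simp add: G_def case_prod_unfold)
    ultimately show ?thesis by simp
  qed
  have FG: "cyclic_cong n (F * G) (of_nat (card A) * G)"
  proof -
    have "F * G = (\<Sum>a\<in>A. \<Sum>j<n. monom 1 (f a + j))"
      by (simp add: F_def G_def sum_product mult_monom)
    moreover have "cyclic_cong n \<dots> (\<Sum>a\<in>A. \<Sum>j<n. monom 1 ((f a + j) mod n))"
      by (intro cyclic_cong_sum cyclic_cong_monom_mod)
    moreover have "(\<Sum>j<n. monom 1 ((f a + j) mod n)) = G" for a
      using sum.reindex_bij_betw[OF bij_betw_add_mod[OF assms(3), of "f a"], of "monom (1::int)"]
      by (simp add: G_def)
    ultimately show ?thesis by simp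
  qed
  have FkH: "cyclic_cong n (F ^ Suc k * H) (of_nat (card A ^ k) * G)" for k
  proof (induction k)
    case 0
    then show ?case using FH by simp
  next
    case (Suc k)
    have "cyclic_cong n (F * (F ^ Suc k * H)) (F * (of_nat (card A ^ k) * G))"
      using Suc by (rule cyclic_cong_mult_left)
    moreover have "cyclic_cong n (of_nat (card A ^ k) * (F * G))
        (of_nat (card A ^ k) * (of_nat (card A) * G))"
      using FG by (rule cyclic_cong_mult_left)
    ultimately show ?case
      by (metis (no_types, lifting) cyclic_cong_trans mult.assoc mult.left_commute
          of_nat_mult power_Suc power_Suc2)
  qed
  obtain V where V: "F ^ r - Fr = of_nat r * V"
    using prime_dvd_freshmans_dream_sum[OF r(1) assms(1), of "\<lambda>a. monom (1::int) (f a)"]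
    by (auto simp: F_def Fr_def monom_power mult.commute dvd_def)
  define W where "W = (\<Sum>i\<le>degree (V * H). monom (coeff (V * H) i) (i mod n))"
  have K: "cyclic_cong n (Fr * H) K"
  proof -
    have "Fr * H = (\<Sum>(a, b)\<in>A \<times> B. monom 1 (r * f a + g b))"
      by (simp add: Fr_def H_def sum_product mult_monom sum.cartesian_product)
    moreover have "cyclic_cong n \<dots> K"
      unfolding K_def by (intro cyclic_cong_sum) (auto intro: cyclic_cong_monom_mod)
    ultimately show ?thesis by simp
  qed
  have W: "cyclic_cong n (of_nat r * (V * H)) (of_nat r * W)"
    unfolding W_def by (intro cyclic_cong_mult_left cyclic_cong_reduce)
  have "F ^ r * H = Fr * H + of_nat r * (V * H)"
    using V by (simp add: algebra_simps)
  then have 1: "cyclic_cong n (F ^ r * H) (K + of_nat r * W)"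
    using cyclic_cong_add[OF K W] by simp
  have "cyclic_cong n (F ^ r * H) (of_nat (card A ^ (r - 1)) * G)"
    using FkH[of "r - 1"] prime_gt_0_nat[OF r(1)] by simp
  then have "cyclic_cong n (K + of_nat r * W) (of_nat (card A ^ (r - 1)) * G)"
    using 1 cyclic_cong_sym cyclic_cong_trans by blast
  moreover have "degree (K + of_nat r * W) < n"
  proof (rule degree_add_less)
    show "degree K < n"
      unfolding K_def using degree_sum_monom_mod_less[OF assms(3), of "\<lambda>_. 1"]
      by (simp add: case_prod_unfold)
    have "degree W < n"
      unfolding W_def by (rule degree_sum_monom_mod_less[OF assms(3)])
    then show "degree (of_nat r * W) < n"
      by (simp add: of_nat_poly le_less_trans[OF degree_smult_le])
  qed
  moreover have "degree (of_nat (card A ^ (r - 1)) * G) < n"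
  proof -
    have "degree G < n"
      unfolding G_def using assms(3)
      by (intro degree_sum_less) (auto intro: le_less_trans[OF degree_monom_le])
    then show ?thesis
      by (simp add: of_nat_poly le_less_trans[OF degree_smult_le])
  qed
  ultimately have eq: "K + of_nat r * W = of_nat (card A ^ (r - 1)) * G"
    by (rule cyclic_cong_imp_eq)
  let ?h = "\<lambda>(a, b). (r * f a + g b) mod n"
  have "{..<n} \<subseteq> ?h ` (A \<times> B)"
  proof
    fix j assume j: "j \<in> {..<n}"
    show "j \<in> ?h ` (A \<times> B)"
    proof (rule ccontr)
      assume "j \<notin> ?h ` (A \<times> B)"
      then have "{x \<in> A \<times> B. ?h x = j} = {}" by auto
      moreover have "coeff K j = int (card {x \<in> A \<times> B. ?h x = j})"
        using coeff_sum_monom[of "A \<times> B" ?h j] assms(1,2) by (simp add: K_def case_prod_unfold)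
      moreover have "coeff G j = 1"
      proof -
        have "{i \<in> {..<n}. i = j} = {j}" using j by auto
        then show ?thesis
          using coeff_sum_monom[of "{..<n}" "\<lambda>i. i" j] by (simp add: G_def)
      qed
      moreover have "coeff (of_nat m * P) j = int m * coeff P j" for m and P :: "int poly"
        by (simp add: of_nat_poly)
      ultimately have "int r * coeff W j = int (card A ^ (r - 1))"
        using arg_cong[OF eq, of "\<lambda>P. coeff P j"]
        by (metis add_0 coeff_add card.empty mult.right_neutral of_nat_0)
      then have "int r dvd int (card A ^ (r - 1))" by (metis dvd_triv_left)
      then have "r dvd card A ^ (r - 1)" by (simp only: int_dvd_int_iff)
      then show False using r prime_dvd_power by blast
    qed
  qed
  then have surj: "?h ` (A \<times> B) = {..<n}" using assms(3) by auto
  moreover have "card (A \<times> B) = n"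
    using bij_betw_same_card[OF assms(4)[unfolded cyclic_tiling_def]] by simp
  ultimately have "inj_on ?h (A \<times> B)"
    using assms(1,2) by (intro eq_card_imp_inj_on) auto
  with surj show ?thesis by (simp add: cyclic_tiling_def bij_betw_def)
qed

text \<open>The number of elements of a tile does not change when it is multiplied, so the prime case can
  be iterated over the prime factors of \<open>k\<close>.\<close>

theorem cyclic_tiling_coprime_multiple:
  assumes "finite A" "finite B" "n > 0" "cyclic_tiling n f A g B"
    and "coprime k (card A)" "k > 0"
  shows "cyclic_tiling n (\<lambda>a. k * f a) A g B"
  using assms(5,6)
proof (induction k rule: prime_divisors_induct)
  case (unit k)
  then show ?case using assms(4) by simp
next
  case (factor r k)
  then have "cyclic_tiling n (\<lambda>a. k * f a) A g B" by simp
  moreover have "\<not> r dvd card A"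
    using factor by (metis coprime_common_divisor coprime_mult_left_iff dvd_refl not_prime_unit)
  ultimately show ?case
    using cyclic_tiling_prime_multiple[OF assms(1-3)] factor(1) by (simp add: mult.assoc)
qed auto

text \<open>Multiplication by the cofactor \<open>m = n / |A|\<close> turns congruence modulo \<open>|A|\<close> into congruence
  modulo \<open>n\<close>, where the multiplied tile is injective.\<close>

lemma cyclic_tiling_incongruent:
  assumes "finite A" "finite B" "n > 0" "cyclic_tiling n f A g B"
    and "n = card A * m" "coprime m (card A)"
    and "a \<in> A" "a' \<in> A" "[f a = f a'] (mod card A)"
  shows "a = a'"
proof -
  have "m > 0" using assms by (cases m) auto
  then have t: "cyclic_tiling n (\<lambda>a. m * f a) A g B"
    using cyclic_tiling_coprime_multiple assms by blast
  have "B \<noteq> {}"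
    using assms(3,4) by (auto simp: cyclic_tiling_def bij_betw_def)
  then obtain b where "b \<in> B" by blast
  have "[m * f a = m * f a'] (mod n)"
    using assms(5,9) by (simp add: cong_def mult.commute mult_mod_right[symmetric])
  then have "[m * f a + g b = m * f a' + g b] (mod n)"
    by (rule cong_add[OF _ cong_refl])
  moreover have "inj_on (\<lambda>(a, b). (m * f a + g b) mod n) (A \<times> B)"
    using t by (simp add: cyclic_tiling_def bij_betw_def)
  ultimately have "(a, b) = (a', b)"
    using \<open>b \<in> B\<close> assms(7,8) by (elim inj_onD) (simp_all add: cong_def)
  then show ?thesis by simp
qed

section \<open>Total perfect codes in Cayley graphs of cyclic groups\<close>

lemma total_perfect_code_cayley_graph_integer_mod_group:
  assumes "n > 0"
  shows "total_perfect_code (cayley_graph (integer_mod_group n) S) C \<longleftrightarrow>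
    C \<subseteq> {0..<int n} \<and> (\<forall>v\<in>{0..<int n}. \<exists>!c. c \<in> C \<and> (c - v) mod int n \<in> S)"
proof -
  let ?G = "cayley_graph (integer_mod_group n) S"
  have carrier: "carrier (integer_mod_group n) = {0..<int n}"
    using assms by (simp add: carrier_integer_mod_group)
  have arc: "v \<rightarrow>\<^bsub>?G\<^esub> c \<longleftrightarrow> (c - v) mod int n \<in> S"
    if "v \<in> {0..<int n}" "c \<in> {0..<int n}" for v c
  proof -
    have "inv\<^bsub>integer_mod_group n\<^esub> v = (- v) mod int n"
      using that carrier by (intro inv_integer_mod_group) simp
    then show ?thesis
      using that by (simp add: cayley_graph_def carrier mod_add_right_eq)
  qed
  have verts: "verts ?G = {0..<int n}"
    by (simp add: cayley_graph_def carrier)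
  show ?thesis
  proof (cases "C \<subseteq> {0..<int n}")
    case True
    have "(\<exists>!c. c \<in> C \<and> v \<rightarrow>\<^bsub>?G\<^esub> c) \<longleftrightarrow> (\<exists>!c. c \<in> C \<and> (c - v) mod int n \<in> S)"
      if "v \<in> {0..<int n}" for v
      using True arc[OF that] by (intro arg_cong[of _ _ Ex1] ext) blast
    then have "(\<forall>v\<in>{0..<int n}. \<exists>!c. c \<in> C \<and> v \<rightarrow>\<^bsub>?G\<^esub> c) \<longleftrightarrow>
        (\<forall>v\<in>{0..<int n}. \<exists>!c. c \<in> C \<and> (c - v) mod int n \<in> S)"
      by (rule ball_cong[OF refl])
    then show ?thesis
      by (simp only: total_perfect_code_def verts)
  qed (simp only: total_perfect_code_def verts simp_thms)
qed

text \<open>Tiles take values in the natural numbers, where \<open>n - s\<close> stands for the residue \<open>- s\<close>.\<close>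

lemma total_perfect_code_imp_cyclic_tiling:
  assumes n: "n > 0" and S: "S \<subseteq> {0..<int n}"
    and C: "total_perfect_code (cayley_graph (integer_mod_group n) S) C"
  shows "cyclic_tiling n (\<lambda>s. nat (int n - s)) S nat C"
proof -
  have sub: "C \<subseteq> {0..<int n}"
    and ex1: "\<And>v. v \<in> {0..<int n} \<Longrightarrow> \<exists>!c. c \<in> C \<and> (c - v) mod int n \<in> S"
    using C n by (auto simp: total_perfect_code_cayley_graph_integer_mod_group)
  have val: "int ((nat (int n - s) + nat c) mod n) = (c - s) mod int n"
    if "s \<in> S" "c \<in> C" for s c
  proof -
    have "0 \<le> s" "s < int n" "0 \<le> c" using that S sub by auto
    then have "int ((nat (int n - s) + nat c) mod n) = (int n + (c - s)) mod int n"
      by (simp add: zmod_int algebra_simps)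
    then show ?thesis by simp
  qed
  let ?h = "\<lambda>(s, c). (nat (int n - s) + nat c) mod n"
  have "inj_on ?h (S \<times> C)"
  proof (intro inj_onI, clarsimp)
    fix s c s' c'
    assume "s \<in> S" "c \<in> C" "s' \<in> S" "c' \<in> C"
      and "(nat (int n - s) + nat c) mod n = (nat (int n - s') + nat c') mod n"
    then have eq: "(c - s) mod int n = (c' - s') mod int n"
      using val by metis
    (* This is the vertex to which both c and c' are adjacent. *)
    define v where "v = (c - s) mod int n"
    have 1: "(c - v) mod int n = s"
      unfolding v_def using S \<open>s \<in> S\<close> by (auto simp: mod_simps)
    have 2: "(c' - v) mod int n = s'"
      unfolding v_def eq using S \<open>s' \<in> S\<close> by (auto simp: mod_simps)
    have "v \<in> {0..<int n}" using n by (simp add: v_def)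
    then have "c = c'" using ex1[of v] 1 2 \<open>c \<in> C\<close> \<open>c' \<in> C\<close> \<open>s \<in> S\<close> \<open>s' \<in> S\<close> by blast
    then show "s = s' \<and> c = c'" using 1 2 by simp
  qed
  moreover have "?h ` (S \<times> C) = {..<n}"
  proof (intro equalityI subsetI)
    fix v assume "v \<in> {..<n}"
    then obtain c where c: "c \<in> C" "(c - int v) mod int n \<in> S"
      using ex1[of "int v"] by auto
    have "int (?h ((c - int v) mod int n, c)) = int v"
      using val[OF c(2,1)] \<open>v \<in> {..<n}\<close> by (simp add: mod_simps)
    then have "?h ((c - int v) mod int n, c) = v" by (simp only: of_nat_eq_iff)
    then show "v \<in> ?h ` (S \<times> C)" using c by (metis (no_types, lifting) SigmaI imageI)
  qed (use n in auto)
  ultimately show ?thesis by (simp add: cyclic_tiling_def bij_betw_def)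
qed

text \<open>By counting, the injectivity makes \<open>S\<close> a complete residue system modulo \<open>|S|\<close>. The neighbour
  \<open>v + s\<close> of \<open>v\<close> is a multiple of \<open>|S|\<close> exactly when \<open>s\<close> is the element of \<open>S\<close> congruent to
  \<open>- v\<close>.\<close>

lemma total_perfect_code_multiples:
  assumes n: "n > 0" and "card S dvd n" and S: "S \<subseteq> {0..<int n}"
    and inj: "\<And>s s'. s \<in> S \<Longrightarrow> s' \<in> S \<Longrightarrow> [s = s'] (mod int (card S)) \<Longrightarrow> s = s'"
  shows "total_perfect_code (cayley_graph (integer_mod_group n) S)
    {c \<in> {0..<int n}. int (card S) dvd c}"
proof -
  let ?m = "int (card S)"
  have m: "?m > 0" using assms(1,2) by (auto intro: Nat.gr0I)
  have dvd: "?m dvd int n" using assms(2) by simp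
  have inj': "inj_on (\<lambda>s. s mod ?m) S"
    by (rule inj_onI) (auto intro: inj simp: cong_def)
  have onto: "(\<lambda>s. s mod ?m) ` S = {0..<?m}"
  proof (rule card_subset_eq)
    show "(\<lambda>s. s mod ?m) ` S \<subseteq> {0..<?m}" using m by auto
  qed (simp_all add: card_image[OF inj'])
  have "\<exists>!c. c \<in> {c \<in> {0..<int n}. ?m dvd c} \<and> (c - v) mod int n \<in> S"
    if v: "v \<in> {0..<int n}" for v
  proof -
    obtain s where s: "s \<in> S" "s mod ?m = (- v) mod ?m"
      using onto m by (metis (no_types, lifting) imageE atLeastLessThan_iff pos_mod_bound pos_mod_sign)
    have "?m dvd v + s"
      using s(2) by (metis add.commute diff_minus_eq_add mod_eq_dvd_iff)
    then have "?m dvd (v + s) mod int n" using dvd by (simp add: dvd_mod_iff)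
    moreover have "((v + s) mod int n - v) mod int n = s"
      using S s(1) by (auto simp: mod_simps)
    moreover have "c = (v + s) mod int n"
      if c: "c \<in> {0..<int n}" "?m dvd c" "(c - v) mod int n \<in> S" for c
    proof -
      have "((c - v) mod int n) mod ?m = (- v) mod ?m"
        using c(2) dvd by (simp add: mod_mod_cancel mod_eq_dvd_iff)
      then have "(c - v) mod int n = s"
        using inj[OF c(3) s(1)] s(2) by (simp add: cong_def)
      then show ?thesis using c(1) by (auto simp: mod_simps)
    qed
    ultimately show ?thesis using s(1) n by (intro ex1I[of _ "(v + s) mod int n"]) auto
  qed
  then show ?thesis
    unfolding total_perfect_code_cayley_graph_integer_mod_group[OF n] by blast
qed

theorem lemma5p5:
  fixes n p q :: nat and S :: "int set"
  assumes n: "n \<in> {p1 ^ k | p1 k. prime p1 \<and> 1 \<le> k}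
                \<union> {p1 ^ k * p2 | p1 p2 k. prime p1 \<and> prime p2 \<and> 1 \<le> k}
                \<union> {p1\<^sup>2 * p2\<^sup>2 | p1 p2. prime p1 \<and> prime p2}
                \<union> {p1 * p2 * p3 | p1 p2 p3. prime p1 \<and> prime p2 \<and> prime p3}
                \<union> {p1\<^sup>2 * p2 * p3 | p1 p2 p3. prime p1 \<and> prime p2 \<and> prime p3}
                \<union> {p1 * p2 * p3 * p4 | p1 p2 p3 p4.
                     prime p1 \<and> prime p2 \<and> prime p3 \<and> prime p4}"
    and "prime p" and "prime q"
    and "p * q dvd n" and "coprime (p * q) (n div (p * q))"
    and "S \<subseteq> carrier (integer_mod_group n) - {0}"
    and "inverse_closed (integer_mod_group n) S"
    and "generate (integer_mod_group n) S = carrier (integer_mod_group n)"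
    and "card S = p * q"
    and "aperiodic (integer_mod_group n) S"
  shows "(\<exists>C. total_perfect_code (cayley_graph (integer_mod_group n) S) C) \<longleftrightarrow>
         (\<forall>s \<in> S. \<forall>s' \<in> S. s \<noteq> s' \<longrightarrow> \<not> [s = s'] (mod int (p * q)))"
proof -
  have n0: "n > 0"
    using n by (auto simp: prime_gt_0_nat)
  have S: "S \<subseteq> {0..<int n}"
    using assms(6) n0 by (auto simp: carrier_integer_mod_group)
  show ?thesis
  proof
    assume "\<exists>C. total_perfect_code (cayley_graph (integer_mod_group n) S) C"
    then obtain C where C: "total_perfect_code (cayley_graph (integer_mod_group n) S) C" ..
    have "finite S" using S by (rule finite_subset) simp
    have "finite C"
      using C n0
      by (auto simp: total_perfect_code_cayley_graph_integer_mod_group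
          intro: finite_subset)
    show "\<forall>s \<in> S. \<forall>s' \<in> S. s \<noteq> s' \<longrightarrow> \<not> [s = s'] (mod int (p * q))"
    proof (intro ballI impI notI)
      fix s s' assume s: "s \<in> S" "s' \<in> S" "s \<noteq> s'" and cong: "[s = s'] (mod int (p * q))"
      have "[int n - s = int n - s'] (mod int (p * q))"
        using cong by (intro cong_diff cong_refl)
      moreover have "int (nat (int n - s)) = int n - s" "int (nat (int n - s')) = int n - s'"
        using S s by auto
      ultimately have "[nat (int n - s) = nat (int n - s')] (mod card S)"
        using assms(9) by (metis cong_int_iff)
      moreover have "n = card S * (n div (p * q))" "coprime (n div (p * q)) (card S)"
        using assms(4,5,9) by (auto simp: coprime_commute)
      ultimately have "s = s'"
        using cyclic_tiling_incongruent[OF \<open>finite S\<close> \<open>finite C\<close> n0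
            total_perfect_code_imp_cyclic_tiling[OF n0 S C]] s(1,2) by blast
      with s(3) show False by simp
    qed
  next
    assume "\<forall>s \<in> S. \<forall>s' \<in> S. s \<noteq> s' \<longrightarrow> \<not> [s = s'] (mod int (p * q))"
    then show "\<exists>C. total_perfect_code (cayley_graph (integer_mod_group n) S) C"
      using total_perfect_code_multiples[OF n0 _ S] assms(4,9) by metis
  qed
qed

end
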